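(* Let $X$ and $Y$ be Tychonoff spaces. If $\varphi: C_p(X)\to C_p^*(Y)$ is a bounded uniform homeomorphism, then $X$ is pseudocompact if and only if $Y$ is pseudocompact.
   Context: For a Tychonoff space $X$, $C_p(X)$ is the space of all continuous real-valued functions on $X$ with the topology of pointwise convergence, and $C_p^*(X)$ is its subspace consisting of the bounded functions. These spaces carry the uniform structure of pointwise convergence (as subspaces of $\mathbb R^X$). A uniform homeomorphism is a bijection that is uniformly continuous together with its inverse. A space is pseudocompact if every continuous real-valued function on it is bounded. For a uniformly continuous surjection $\varphi:C_p(X)\to C_p^*(Y)$, $y\in Y$ and $K\subset X$ put $$a_\varphi(y,K)=\sup\{|\varphi(f)(y)-\varphi(g)(y)|: f,g\in C_p(X)\text{ and } |f(x)-g(x)|<1\ \ \forall x\in K\}\in[0,\infty].$$ The map $\varphi$ is called bounded if there is $m\in\mathbb N$ such that for every $y\in Y$ there is a finite set $K\subset X$ with $a_\varphi(y,K)\leq m$. *)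

theory Defs
  imports "HOL-Analysis.Analysis"
begin

definition tychonoff_space :: "'a topology \<Rightarrow> bool" where
  "tychonoff_space X \<longleftrightarrow> completely_regular_space X \<and> Hausdorff_space X"

definition pseudocompact_space :: "'a topology \<Rightarrow> bool" where
  "pseudocompact_space X \<longleftrightarrow>
     (\<forall>f. continuous_map X euclideanreal f \<longrightarrow> bounded (f ` topspace X))"

(* continuous_map only constrains values on topspace X; extensionality makes each
   continuous function on the space correspond to exactly one element. *)
definition Cp :: "'a topology \<Rightarrow> ('a \<Rightarrow> real) set" where
  "Cp X = {f \<in> extensional (topspace X). continuous_map X euclideanreal f}"

definition Cp_star :: "'a topology \<Rightarrow> ('a \<Rightarrow> real) set" where
  "Cp_star X = {f \<in> Cp X. bounded (f ` topspace X)}"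

(* The trace on F of the product uniformity of real^S, i.e. the coarsest uniformity
   making all evaluations at points of S uniformly continuous. *)
definition pointwise_uniformity :: "'a set \<Rightarrow> ('a \<Rightarrow> real) set \<Rightarrow> (('a \<Rightarrow> real) \<times> ('a \<Rightarrow> real)) filter" where
  "pointwise_uniformity S F =
     inf (INF x\<in>S. filtercomap (\<lambda>(f, g). (f x, g x)) uniformity) (principal (F \<times> F))"

lemma eventually_pointwise_uniformity:
  "eventually P (pointwise_uniformity S F) \<longleftrightarrow>
     (\<exists>K e. finite K \<and> K \<subseteq> S \<and> e > 0 \<and>
        (\<forall>f\<in>F. \<forall>g\<in>F. (\<forall>x\<in>K. \<bar>f x - g x\<bar> < e) \<longrightarrow> P (f, g)))"
    (is "?L \<longleftrightarrow> ?R")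
proof
  let ?U = "\<lambda>x. filtercomap (\<lambda>(f :: 'a \<Rightarrow> real, g). (f x, g x)) uniformity"
  assume ?L
  then have "eventually (\<lambda>p. p \<in> F \<times> F \<longrightarrow> P p) (INF x\<in>S. ?U x)"
    by (simp add: pointwise_uniformity_def eventually_inf_principal)
  then obtain K where K: "finite K" "K \<subseteq> S"
    and ev: "eventually (\<lambda>p. p \<in> F \<times> F \<longrightarrow> P p) (INF x\<in>K. ?U x)"
    unfolding eventually_INF[of _ _ S] by blast
  from ev obtain Q where Q: "\<And>x. x \<in> K \<Longrightarrow> eventually (Q x) (?U x)"
    and QP: "\<And>p. (\<forall>x\<in>K. Q x p) \<Longrightarrow> p \<in> F \<times> F \<longrightarrow> P p"
    unfolding eventually_INF_finite[OF K(1)] by blast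
  have "\<exists>e>0. \<forall>f g. \<bar>f x - g x\<bar> < e \<longrightarrow> Q x (f, g)" if x: "x \<in> K" for x
  proof -
    obtain R where R: "eventually R (uniformity :: (real \<times> real) filter)"
      and RQ: "\<And>f g. R (f x, g x) \<Longrightarrow> Q x (f, g)"
      using Q[OF x] unfolding eventually_filtercomap by fastforce
    then show ?thesis
      unfolding eventually_uniformity_metric dist_real_def by blast
  qed
  then obtain d where d: "\<And>x. x \<in> K \<Longrightarrow> d x > 0"
    and dQ: "\<And>x f g. x \<in> K \<Longrightarrow> \<bar>f x - g x\<bar> < d x \<Longrightarrow> Q x (f, g)"
    by metis
  define e where "e = Min (insert 1 (d ` K))"
  have e: "e > 0" "\<And>x. x \<in> K \<Longrightarrow> e \<le> d x"
    using d K(1) by (auto simp: e_def)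
  have "\<forall>f\<in>F. \<forall>g\<in>F. (\<forall>x\<in>K. \<bar>f x - g x\<bar> < e) \<longrightarrow> P (f, g)"
    using QP dQ e(2) by (metis SigmaI order_less_le_trans)
  then show ?R using K e(1) by blast
next
  let ?U = "\<lambda>x. filtercomap (\<lambda>(f :: 'a \<Rightarrow> real, g). (f x, g x)) uniformity"
  assume ?R
  then obtain K e where K: "finite K" "K \<subseteq> S" and e: "e > 0"
    and P: "\<And>f g. f \<in> F \<Longrightarrow> g \<in> F \<Longrightarrow> \<forall>x\<in>K. \<bar>f x - g x\<bar> < e \<Longrightarrow> P (f, g)"
    by blast
  have "eventually (\<lambda>p. \<bar>fst p x - snd p x\<bar> < e) (INF x\<in>S. ?U x)" if "x \<in> K" for x
  proof (rule filter_leD[of _ "?U x"])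
    show "(INF x\<in>S. ?U x) \<le> ?U x" using that K by (intro INF_lower) auto
    show "eventually (\<lambda>p. \<bar>fst p x - snd p x\<bar> < e) (?U x)"
      unfolding eventually_filtercomap eventually_uniformity_metric dist_real_def
      by (intro exI[of _ "\<lambda>(a, b). \<bar>a - b\<bar> < e"] conjI exI[of _ e]) (use e in auto)
  qed
  then have "eventually (\<lambda>p. \<forall>x\<in>K. \<bar>fst p x - snd p x\<bar> < e) (INF x\<in>S. ?U x)"
    using K(1) by (simp add: eventually_ball_finite_distrib)
  then show ?L
    unfolding pointwise_uniformity_def eventually_inf_principal
    by (rule eventually_mono) (use P in auto)
qed

definition Cp_uniformity :: "'a topology \<Rightarrow> (('a \<Rightarrow> real) \<times> ('a \<Rightarrow> real)) filter" where
  "Cp_uniformity X = pointwise_uniformity (topspace X) (Cp X)"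

definition Cp_star_uniformity :: "'a topology \<Rightarrow> (('a \<Rightarrow> real) \<times> ('a \<Rightarrow> real)) filter" where
  "Cp_star_uniformity X = pointwise_uniformity (topspace X) (Cp_star X)"

(* As in uniformly_continuous_on_uniformity, but for explicitly given uniformities
   (HOL-Analysis has no uniform_space instance for functions on an arbitrary domain). *)
definition uniformly_continuous_wrt ::
  "('a \<times> 'a) filter \<Rightarrow> ('b \<times> 'b) filter \<Rightarrow> ('a \<Rightarrow> 'b) \<Rightarrow> bool" where
  "uniformly_continuous_wrt U V \<phi> \<longleftrightarrow> (LIM (f, g) U. (\<phi> f, \<phi> g) :> V)"

definition uniform_homeomorphism ::
  "'a set \<Rightarrow> ('a \<times> 'a) filter \<Rightarrow> 'b set \<Rightarrow> ('b \<times> 'b) filter \<Rightarrow> ('a \<Rightarrow> 'b) \<Rightarrow> bool" where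
  "uniform_homeomorphism F U G V \<phi> \<longleftrightarrow>
     bij_betw \<phi> F G \<and> uniformly_continuous_wrt U V \<phi> \<and>
     uniformly_continuous_wrt V U (inv_into F \<phi>)"

definition a_phi ::
  "'a topology \<Rightarrow> (('a \<Rightarrow> real) \<Rightarrow> ('b \<Rightarrow> real)) \<Rightarrow> 'b \<Rightarrow> 'a set \<Rightarrow> ennreal" where
  "a_phi X \<phi> y K =
     Sup {ennreal \<bar>\<phi> f y - \<phi> g y\<bar> | f g. f \<in> Cp X \<and> g \<in> Cp X \<and> (\<forall>x\<in>K. \<bar>f x - g x\<bar> < 1)}"

definition bounded_Cp_map ::
  "'a topology \<Rightarrow> 'b topology \<Rightarrow> (('a \<Rightarrow> real) \<Rightarrow> ('b \<Rightarrow> real)) \<Rightarrow> bool" where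
  "bounded_Cp_map X Y \<phi> \<longleftrightarrow>
     (\<exists>m::nat. \<forall>y\<in>topspace Y. \<exists>K. finite K \<and> K \<subseteq> topspace X \<and> a_phi X \<phi> y K \<le> of_nat m)"

end

theory Submission
  imports Defs
begin

text \<open>
  Both spaces turn out to be pseudocompact. Let \<open>\<psi>\<close> be the inverse of \<open>\<phi>\<close>.

  The set \<open>{h. \<bar>h\<bar> \<le> n}\<close> is convex, so each \<open>x \<mapsto> \<psi> h x\<close> is bounded on it by uniform continuity;
  hence \<open>Cp X\<close> is a countable union of pointwise bounded sets, and a diagonal argument along a
  sequence on which some continuous function tends to infinity shows that \<open>X\<close> is pseudocompact.

  If \<open>Y\<close> is not pseudocompact, adding up bumps of a large height over subsets of a discrete
  sequence gives a Cantor set of functions \<open>h a\<close> in \<open>Cp_star Y\<close> at large mutual sup-distance.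
  The functions \<open>\<psi> (h a)\<close> depend continuously on \<open>a\<close>, so their values are determined by the
  countably many finite \<open>a\<close>. These map the pseudocompact space \<open>X\<close> onto a compact metrizable space
  through which all \<open>\<psi> (h a)\<close> factor, so two of them are uniformly within 1. Boundedness of \<open>\<phi>\<close>
  contradicts the choice of the height.
\<close>

section \<open>Pseudocompact spaces\<close>

text \<open>A limit \<open>p\<close> of the image lying outside it would make
  \<open>inverse (dist (e x) p)\<close> continuous and unbounded, so the image is closed. Each
  coordinate is bounded, which puts the image inside a product of compact intervals. Countability of
  the index type makes the function space metric.\<close>

lemma pseudocompact_imp_compact_image:
  fixes e :: "'a \<Rightarrow> 'i::countable \<Rightarrow> real"
  assumes X: "pseudocompact_space X"
    and cont: "\<And>i. continuous_map X euclideanreal (\<lambda>x. e x i)"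
  shows "compact (e ` topspace X)"
proof -
  have ce: "continuous_map X euclidean e"
    using cont continuous_map_componentwise_UNIV[of X "\<lambda>_. euclideanreal" e]
    by (simp add: euclidean_product_topology)
  have "closed (e ` topspace X)"
  proof (rule ccontr)
    assume "\<not> closed (e ` topspace X)"
    then obtain p where p: "p \<in> closure (e ` topspace X)" "p \<notin> e ` topspace X"
      using closure_subset_eq by blast
    have pos: "dist (e x) p > 0" if "x \<in> topspace X" for x
      using p(2) that by auto
    have "continuous_map euclidean euclideanreal (\<lambda>q. dist q p)"
      by (auto intro!: continuous_intros)
    from continuous_map_compose[OF ce this]
    have "continuous_map X euclideanreal (\<lambda>x. dist (e x) p)"
      by (simp add: o_def)
    then have "continuous_map X euclideanreal (\<lambda>x. inverse (dist (e x) p))"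
      using pos by (intro continuous_map_real_inverse) fastforce+
    then have "bounded ((\<lambda>x. inverse (dist (e x) p)) ` topspace X)"
      using X by (simp add: pseudocompact_space_def)
    then obtain B where B: "B > 0" "\<And>x. x \<in> topspace X \<Longrightarrow> \<bar>inverse (dist (e x) p)\<bar> \<le> B"
      unfolding bounded_pos by auto
    obtain x where x: "x \<in> topspace X" "dist (e x) p < inverse B"
      using p(1) B(1) unfolding closure_approachable by (metis imageE inverse_positive_iff_positive)
    have "B < inverse (dist (e x) p)"
      using x pos[OF x(1)] B(1) by (metis inverse_inverse_eq less_imp_inverse_less)
    with B(2)[OF x(1)] show False by linarith
  qed
  moreover
  have "\<exists>B. \<forall>x\<in>topspace X. \<bar>e x i\<bar> \<le> B" for i
    using X cont[of i] unfolding pseudocompact_space_def bounded_iff by (metis image_eqI real_norm_def)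
  then obtain B where B: "\<And>i x. x \<in> topspace X \<Longrightarrow> \<bar>e x i\<bar> \<le> B i"
    by metis
  have "compactin (product_topology (\<lambda>_. euclideanreal) UNIV) (Pi\<^sub>E UNIV (\<lambda>i. {- B i..B i}))"
    by (simp add: compactin_PiE)
  then have "compact (Pi\<^sub>E UNIV (\<lambda>i. {- B i..B i}))"
    by (simp add: euclidean_product_topology)
  moreover have "e ` topspace X \<subseteq> Pi\<^sub>E UNIV (\<lambda>i. {- B i..B i})"
    using B by (force simp: abs_le_iff)
  ultimately show ?thesis
    using compact_Int_closed by (metis inf.absorb2)
qed

text \<open>With \<open>f\<close> adjoined as one more coordinate, the image of the space is
  compact. Forgetting that coordinate is injective on it by \<open>sep\<close>, hence a
  homeomorphism onto the image under \<open>D\<close>, and \<open>F\<close> reads \<open>f\<close>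
  off the inverse.\<close>

lemma pseudocompact_countably_separated_factor:
  fixes D :: "nat \<Rightarrow> 'a \<Rightarrow> real"
  assumes X: "pseudocompact_space X"
    and D: "\<And>n. continuous_map X euclideanreal (D n)"
    and f: "continuous_map X euclideanreal f"
    and sep: "\<And>x x'. x \<in> topspace X \<Longrightarrow> x' \<in> topspace X \<Longrightarrow> (\<forall>n. D n x = D n x') \<Longrightarrow> f x = f x'"
  obtains F where "continuous_on ((\<lambda>x n. D n x) ` topspace X) F"
    and "\<And>x. x \<in> topspace X \<Longrightarrow> F (\<lambda>n. D n x) = f x"
proof -
  define e where "e x = (\<lambda>i. case i of None \<Rightarrow> f x | Some n \<Rightarrow> D n x)" for x
  define pr where "pr q = (\<lambda>n. q (Some n))" for q :: "nat option \<Rightarrow> real"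
  let ?E = "e ` topspace X"
  have pr_e: "pr (e x) = (\<lambda>n. D n x)" and e_None: "e x None = f x" for x
    by (simp_all add: pr_def e_def)
  have comp: "compact ?E"
  proof (rule pseudocompact_imp_compact_image[OF X])
    show "continuous_map X euclideanreal (\<lambda>x. e x i)" for i
      using D f by (cases i) (simp_all add: e_def)
  qed
  have cpr: "continuous_on ?E pr"
    unfolding pr_def
    by (rule continuous_on_coordinatewise_then_product)
      (rule continuous_on_subset[OF continuous_on_product_coordinates subset_UNIV])
  have inj: "inj_on pr ?E"
  proof (rule inj_onI, clarify)
    fix x x' assume x: "x \<in> topspace X" "x' \<in> topspace X" and eq: "pr (e x) = pr (e x')"
    have "\<forall>n. D n x = D n x'" using eq by (metis pr_e)
    with sep[OF x] show "e x = e x'"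
      by (auto simp: e_def fun_eq_iff split: option.split)
  qed
  define F where "F q = the_inv_into ?E pr q None" for q
  have im: "pr ` ?E = (\<lambda>x n. D n x) ` topspace X"
    by (simp add: image_image pr_e)
  show thesis
  proof
    show "continuous_on ((\<lambda>x n. D n x) ` topspace X) F"
      unfolding F_def im[symmetric]
      by (rule continuous_on_product_then_coordinatewise[OF continuous_on_inv_into[OF cpr comp inj]])
    show "F (\<lambda>n. D n x) = f x" if "x \<in> topspace X" for x
      unfolding F_def pr_e[symmetric] e_None[symmetric]
      using the_inv_into_f_f[OF inj] that by simp
  qed
qed

text \<open>By the factorization, every member of \<open>F\<close> induces a continuous function on
  one compact metrizable space. Such functions form a separable space under the supremum norm, so
  uncountably many of them cannot stay \<open>\<epsilon>\<close> apart.\<close>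

lemma pseudocompact_countably_separated_close:
  fixes D :: "nat \<Rightarrow> 'a \<Rightarrow> real"
  assumes X: "pseudocompact_space X"
    and D: "\<And>n. continuous_map X euclideanreal (D n)"
    and F: "\<And>f. f \<in> F \<Longrightarrow> continuous_map X euclideanreal f"
    and sep: "\<And>f x x'. f \<in> F \<Longrightarrow> x \<in> topspace X \<Longrightarrow> x' \<in> topspace X
                \<Longrightarrow> (\<forall>n. D n x = D n x') \<Longrightarrow> f x = f x'"
    and unc: "uncountable F" and "\<epsilon> > 0"
  obtains f g where "f \<in> F" "g \<in> F" "f \<noteq> g" "\<And>x. x \<in> topspace X \<Longrightarrow> \<bar>f x - g x\<bar> < \<epsilon>"
proof -
  define p where "p x = (\<lambda>n. D n x)" for x
  let ?P = "p ` topspace X"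
  have comp: "compact ?P"
    by (rule pseudocompact_imp_compact_image[OF X]) (simp add: p_def D)
  \<comment> \<open>Keeping the finite nets as lists lets the rounded values of a function along a
    net form a list of integers, an element of a countable type.\<close>
  have "\<forall>n. \<exists>xs. set xs \<subseteq> topspace X
      \<and> (\<forall>x\<in>topspace X. \<exists>c\<in>set xs. dist (p c) (p x) < inverse (Suc n))"
  proof
    fix n
    obtain k where k: "finite k" "k \<subseteq> ?P" "?P \<subseteq> (\<Union>q\<in>k. ball q (inverse (Suc n)))"
      using seq_compact_imp_totally_bounded[OF compact_imp_seq_compact[OF comp]]
      by (metis inverse_positive_iff_positive of_nat_0_less_iff zero_less_Suc)
    obtain c where c: "finite c" "c \<subseteq> topspace X" "k = p ` c"
      using finite_subset_image[OF k(1,2)] by blast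
    obtain xs where "set xs = c"
      using finite_list[OF c(1)] by blast
    with c k(3) show "\<exists>xs. set xs \<subseteq> topspace X
        \<and> (\<forall>x\<in>topspace X. \<exists>c\<in>set xs. dist (p c) (p x) < inverse (Suc n))"
      by (intro exI[of _ xs]) (fastforce simp: subset_iff)
  qed
  from choice[OF this] obtain net where "\<forall>n. set (net n) \<subseteq> topspace X
      \<and> (\<forall>x\<in>topspace X. \<exists>c\<in>set (net n). dist (p c) (p x) < inverse (Suc n))"
    by (rule exE)
  then have net: "\<And>n. set (net n) \<subseteq> topspace X"
    "\<And>n x. x \<in> topspace X \<Longrightarrow> \<exists>c\<in>set (net n). dist (p c) (p x) < inverse (Suc n)"
    by blast+
  have "\<forall>f\<in>F. \<exists>n. \<forall>x\<in>topspace X. \<forall>x'\<in>topspace X.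
          dist (p x) (p x') < inverse (Suc n) \<longrightarrow> \<bar>f x - f x'\<bar> < \<epsilon> / 3"
  proof
    fix f assume f: "f \<in> F"
    have D_sep: "\<And>x x'. x \<in> topspace X \<Longrightarrow> x' \<in> topspace X \<Longrightarrow> \<forall>n. D n x = D n x' \<Longrightarrow> f x = f x'"
      by (rule sep[OF f])
    obtain G where "continuous_on ((\<lambda>x n. D n x) ` topspace X) G"
      "\<And>x. x \<in> topspace X \<Longrightarrow> G (\<lambda>n. D n x) = f x"
      using pseudocompact_countably_separated_factor[where D = D, OF X D F[OF f] D_sep] by blast
    then have G: "continuous_on ?P G" "\<And>x. x \<in> topspace X \<Longrightarrow> G (p x) = f x"
      by (simp_all add: p_def[abs_def])
    have "uniformly_continuous_on ?P G"
      by (rule compact_uniformly_continuous[OF G(1) comp])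
    then obtain d where d: "d > 0"
      "\<And>q q'. q \<in> ?P \<Longrightarrow> q' \<in> ?P \<Longrightarrow> dist q' q < d \<Longrightarrow> dist (G q') (G q) < \<epsilon> / 3"
      using \<open>\<epsilon> > 0\<close> unfolding uniformly_continuous_on_def by (metis divide_pos_pos zero_less_numeral)
    obtain n where n: "inverse (real (Suc n)) < d"
      using reals_Archimedean[OF d(1)] by blast
    have "\<bar>f x - f x'\<bar> < \<epsilon> / 3"
      if "x \<in> topspace X" "x' \<in> topspace X" "dist (p x) (p x') < inverse (Suc n)" for x x'
      using d(2)[of "p x'" "p x"] that n by (simp add: G(2) dist_real_def)
    then show "\<exists>n. \<forall>x\<in>topspace X. \<forall>x'\<in>topspace X.
          dist (p x) (p x') < inverse (Suc n) \<longrightarrow> \<bar>f x - f x'\<bar> < \<epsilon> / 3"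
      by blast
  qed
  from bchoice[OF this] obtain N where "\<forall>f\<in>F. \<forall>x\<in>topspace X. \<forall>x'\<in>topspace X.
      dist (p x) (p x') < inverse (Suc (N f)) \<longrightarrow> \<bar>f x - f x'\<bar> < \<epsilon> / 3"
    by (rule exE)
  then have N: "\<And>f x x'. f \<in> F \<Longrightarrow> x \<in> topspace X \<Longrightarrow> x' \<in> topspace X
      \<Longrightarrow> dist (p x) (p x') < inverse (Suc (N f)) \<Longrightarrow> \<bar>f x - f x'\<bar> < \<epsilon> / 3"
    by blast
  \<comment> \<open>A function in \<open>F\<close> is determined up to \<open>\<epsilon>\<close> by its rounded values on a suitable net,
    and these codes form a countable type.\<close>
  define code where "code f = (N f, map (\<lambda>c. \<lfloor>f c * 3 / \<epsilon>\<rfloor>) (net (N f)))" for f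
  have "\<not> inj_on code F"
    using unc countable_image_inj_on[OF countableI_type, of code F] by blast
  then obtain f g where fg: "f \<in> F" "g \<in> F" "f \<noteq> g" and code: "code f = code g"
    by (auto simp: inj_on_def)
  show thesis
  proof (rule that[OF fg])
    fix x assume x: "x \<in> topspace X"
    obtain c where c: "c \<in> set (net (N f))" "dist (p c) (p x) < inverse (Suc (N f))"
      using net(2)[OF x] by blast
    have cX: "c \<in> topspace X" using net(1) c(1) by blast
    have Neq: "N f = N g" using code by (simp add: code_def)
    \<comment> \<open>Three errors below \<open>\<epsilon> / 3\<close> add up: the rounding at
      \<open>c\<close>, and the changes of \<open>f\<close> and of \<open>g\<close> between
      \<open>c\<close> and \<open>x\<close>.\<close>
    have "\<lfloor>f c * 3 / \<epsilon>\<rfloor> = \<lfloor>g c * 3 / \<epsilon>\<rfloor>"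
      using code c(1) by (auto simp: code_def)
    then have "\<bar>f c * 3 / \<epsilon> - g c * 3 / \<epsilon>\<bar> < 1"
      by linarith
    then have "\<bar>f c - g c\<bar> * 3 / \<epsilon> < 1"
      using \<open>\<epsilon> > 0\<close> by (simp add: abs_if field_simps split: if_splits)
    then have "\<bar>f c - g c\<bar> < \<epsilon> / 3"
      using \<open>\<epsilon> > 0\<close> by (simp add: field_simps)
    moreover have "\<bar>f c - f x\<bar> < \<epsilon> / 3" "\<bar>g c - g x\<bar> < \<epsilon> / 3"
      using N[OF fg(1) cX x] N[OF fg(2) cX x] c(2) Neq by auto
    ultimately show "\<bar>f x - g x\<bar> < \<epsilon>" by linarith
  qed
qed

text \<open>The gaps make the values \<open>g (p n)\<close> a closed discrete set of reals, on which
  arbitrary values can be prescribed, and keep bumps of radius 1 around them disjoint.\<close>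

lemma not_pseudocompact_obtains_sequence:
  assumes "\<not> pseudocompact_space X"
  obtains g :: "'a \<Rightarrow> real" and p :: "nat \<Rightarrow> 'a" where "continuous_map X euclideanreal g"
    and "\<And>n. p n \<in> topspace X"
    and "\<And>i j. i < j \<Longrightarrow> g (p i) + 2 < g (p j)"
    and "\<And>n. real n \<le> g (p n)"
proof -
  obtain f where f: "continuous_map X euclideanreal f" "\<not> bounded (f ` topspace X)"
    using assms by (auto simp: pseudocompact_space_def)
  define g where "g x = \<bar>f x\<bar>" for x
  have "\<exists>x\<in>topspace X. c < g x" for c
    using f(2) unfolding bounded_iff g_def by (metis imageE linorder_not_le real_norm_def)
  then obtain q where q: "\<And>c. q c \<in> topspace X" "\<And>c. c < g (q c)"
    by metis
  \<comment> \<open>Each new point is chosen so that \<open>g\<close> exceeds its previous value by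
    more than 2.\<close>
  define p where "p = rec_nat (q 0) (\<lambda>_ x. q (g x + 2))"
  have p_simps: "p 0 = q 0" "p (Suc n) = q (g (p n) + 2)" for n
    by (simp_all add: p_def)
  have step: "g (p n) + 2 < g (p (Suc n))" for n
    using q(2) by (simp add: p_simps)
  have mono: "g (p i) + 2 < g (p j)" if "i < j" for i j
    using that
  proof (induction j)
    case (Suc j)
    then show ?case using step[of j] by (cases "i = j") auto
  qed simp
  show thesis
  proof (rule that[of g p])
    show "continuous_map X euclideanreal g"
      unfolding g_def using f(1) by (rule continuous_map_real_abs)
    show "p n \<in> topspace X" for n
      using q(1) by (cases n) (simp_all add: p_simps)
    show "g (p i) + 2 < g (p j)" if "i < j" for i j
      by (rule mono[OF that])
    show "real n \<le> g (p n)" for n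
    proof (induction n)
      case 0 then show ?case by (simp add: g_def)
    next
      case (Suc n) then show ?case using step[of n] by simp
    qed
  qed
qed

text \<open>The range of \<open>r\<close> is closed and discrete, so every function on it is
  continuous and extends by Tietze's theorem.\<close>

lemma obtain_continuous_interpolation:
  fixes c :: "nat \<Rightarrow> real"
  assumes "\<And>i j. i < j \<Longrightarrow> r i + (2::real) < r j"
  obtains w where "continuous_on UNIV w" "\<And>n. w (r n) = c n"
proof -
  have apart: "i = j" if "dist (r i) (r j) < 1" for i j
    using that assms[of i j] assms[of j i] by (cases i j rule: linorder_cases) (auto simp: dist_real_def)
  have "closed (range r)"
    by (rule discrete_imp_closed[of 1]) (auto dest: apart)
  then have cl: "closedin (top_of_set UNIV) (range r)" by simp
  have inj: "inj r"
    by (rule injI, rule apart) simp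
  have "continuous_on (range r) (c \<circ> inv r)"
    unfolding continuous_on_iff
  proof (intro ballI allI impI exI conjI)
    fix s s' and e :: real
    assume "s \<in> range r" "s' \<in> range r" "dist s' s < 1" "e > 0"
    then have "s' = s" using apart by blast
    then show "dist ((c \<circ> inv r) s') ((c \<circ> inv r) s) < e" using \<open>e > 0\<close> by simp
  qed simp
  from Tietze_unbounded[OF this cl] obtain w
    where "continuous_on UNIV w" "\<And>s. s \<in> range r \<Longrightarrow> w s = (c \<circ> inv r) s"
    by metis
  with that show thesis using inj by (simp add: inv_f_f)
qed

section \<open>Spaces of continuous functions\<close>

lemma restrict_in_Cp:
  assumes "continuous_map X euclideanreal f"
  shows "restrict f (topspace X) \<in> Cp X"
  unfolding Cp_def using continuous_map_eq[OF assms, of "restrict f (topspace X)"] by simp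

lemma uniformly_continuous_pointwiseD:
  assumes "uniformly_continuous_wrt (pointwise_uniformity S F) (pointwise_uniformity T G) \<psi>"
    and x: "x \<in> T" and e: "e > 0"
  obtains K d where "finite K" "K \<subseteq> S" "d > 0"
    "\<And>f g. f \<in> F \<Longrightarrow> g \<in> F \<Longrightarrow> (\<And>y. y \<in> K \<Longrightarrow> \<bar>f y - g y\<bar> < d) \<Longrightarrow> \<bar>\<psi> f x - \<psi> g x\<bar> < e"
proof -
  have "eventually (\<lambda>(f, g). \<bar>f x - g x\<bar> < e) (pointwise_uniformity T G)"
    unfolding eventually_pointwise_uniformity
    by (rule exI[of _ "{x}"], rule exI[of _ e]) (use x e in auto)
  then have "eventually (\<lambda>(f, g). \<bar>\<psi> f x - \<psi> g x\<bar> < e) (pointwise_uniformity S F)"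
    using assms(1) unfolding uniformly_continuous_wrt_def filterlim_iff
    by (force simp: case_prod_unfold)
  then show thesis
    unfolding eventually_pointwise_uniformity using that by fastforce
qed

text \<open>The segment from 0 to \<open>h\<close> splits into \<open>k\<close> equal steps, each
  changing \<open>\<psi>\<close> at \<open>x\<close> by less than 1. The number \<open>k\<close>
  depends on \<open>r\<close> and \<open>d\<close> only, not on \<open>h\<close>.\<close>

lemma uniformly_continuous_bounded_on_ball:
  assumes uc: "uniformly_continuous_wrt (Cp_star_uniformity Y) (Cp_uniformity X) \<psi>"
    and x: "x \<in> topspace X"
  obtains B where "\<And>h. h \<in> Cp_star Y \<Longrightarrow> (\<And>y. y \<in> topspace Y \<Longrightarrow> \<bar>h y\<bar> \<le> r) \<Longrightarrow> \<psi> h x \<le> B"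
proof -
  obtain K d where K: "K \<subseteq> topspace Y" "d > 0"
    and *: "\<And>f g. f \<in> Cp_star Y \<Longrightarrow> g \<in> Cp_star Y \<Longrightarrow> (\<And>y. y \<in> K \<Longrightarrow> \<bar>f y - g y\<bar> < d)
       \<Longrightarrow> \<bar>\<psi> f x - \<psi> g x\<bar> < 1"
    using uniformly_continuous_pointwiseD[OF uc[unfolded Cp_star_uniformity_def Cp_uniformity_def] x, of 1]
    by (metis zero_less_one)
  \<comment> \<open>This makes one step, of size at most \<open>r / k\<close>, smaller than
    \<open>d\<close>.\<close>
  obtain k :: nat where k: "r / d < real k" "k > 0"
    by (metis reals_Archimedean2 gr0I less_trans of_nat_0 of_nat_1 zero_less_one zero_neq_one not_less_iff_gr_or_eq)
  define z where "z = restrict (\<lambda>_. 0::real) (topspace Y)"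
  have "\<psi> h x \<le> \<psi> z x + real k" if h: "h \<in> Cp_star Y" and hr: "\<And>y. y \<in> topspace Y \<Longrightarrow> \<bar>h y\<bar> \<le> r" for h
  proof -
    define H where "H j = restrict (\<lambda>y. real j / real k * h y) (topspace Y)" for j
    have hc: "continuous_map Y euclideanreal h" "bounded (h ` topspace Y)"
      "h \<in> extensional (topspace Y)"
      using h by (auto simp: Cp_star_def Cp_def)
    have Hin: "H j \<in> Cp_star Y" for j
    proof -
      have "bounded ((\<lambda>t. real j / real k * t) ` h ` topspace Y)"
        using bounded_scaling[OF hc(2), of "real j / real k"] by (simp only: real_scaleR_def)
      then have "bounded (H j ` topspace Y)"
        by (simp add: H_def image_image cong: image_cong)
      then show ?thesis
        unfolding Cp_star_def H_def using restrict_in_Cp[OF continuous_map_real_mult_left[OF hc(1)]]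
        by blast
    qed
    have "\<bar>\<psi> (H (Suc j)) x - \<psi> (H j) x\<bar> < 1" for j
    proof (rule *[OF Hin Hin])
      fix y assume "y \<in> K"
      then have y: "y \<in> topspace Y" using K by blast
      have "H (Suc j) y - H j y = h y / real k"
        using y by (simp add: H_def add_divide_distrib algebra_simps)
      then have "\<bar>H (Suc j) y - H j y\<bar> \<le> r / real k"
        using hr[OF y] by (simp add: divide_right_mono)
      also have "r / real k < d"
        using k K(2) by (simp add: field_simps)
      finally show "\<bar>H (Suc j) y - H j y\<bar> < d" .
    qed
    then have "\<psi> (H (Suc j)) x \<le> \<psi> (H j) x + 1" for j
      by (smt (verit))
    then have "\<psi> (H j) x \<le> \<psi> (H 0) x + real j" for j
      by (induction j) (simp, smt (verit) of_nat_Suc)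
    moreover have "H 0 = z" by (simp add: H_def z_def)
    moreover have "H k = h"
      unfolding H_def using k(2) hc(3) by (simp add: extensional_restrict)
    ultimately show ?thesis by metis
  qed
  then show thesis by (rule that)
qed

text \<open>Each \<open>h\<close> in \<open>Cp_star Y\<close> is bounded by some natural number
  \<open>n\<close>, which forces \<open>\<psi> h (p n) \<le> B n\<close>. A continuous function
  exceeding \<open>B n\<close> at every \<open>p n\<close> thus has no preimage.\<close>

theorem uniformly_continuous_surj_imp_pseudocompact:
  assumes uc: "uniformly_continuous_wrt (Cp_star_uniformity Y) (Cp_uniformity X) \<psi>"
    and surj: "Cp X \<subseteq> \<psi> ` Cp_star Y"
  shows "pseudocompact_space X"
proof (rule ccontr)
  assume X: "\<not> pseudocompact_space X"
  obtain g p where g: "continuous_map X euclideanreal g" and p: "\<And>n. p n \<in> topspace X"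
    and gap: "\<And>i j. i < j \<Longrightarrow> g (p i) + 2 < g (p j)" and "\<And>n. real n \<le> g (p n)"
    using not_pseudocompact_obtains_sequence[OF X] by blast
  have "\<exists>B. \<forall>h\<in>Cp_star Y. (\<forall>y\<in>topspace Y. \<bar>h y\<bar> \<le> real n) \<longrightarrow> \<psi> h (p n) \<le> B" for n
    using uniformly_continuous_bounded_on_ball[OF uc p[of n], of "real n"] by metis
  then obtain B where B: "\<And>n h. h \<in> Cp_star Y \<Longrightarrow> (\<forall>y\<in>topspace Y. \<bar>h y\<bar> \<le> real n) \<Longrightarrow> \<psi> h (p n) \<le> B n"
    by metis
  obtain w where w: "continuous_on UNIV w" "\<And>n. w (g (p n)) = B n + 1"
    using obtain_continuous_interpolation[of "\<lambda>n. g (p n)" "\<lambda>n. B n + 1"] gap by metis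
  have "continuous_map X euclideanreal (w \<circ> g)"
    using g w(1) by (intro continuous_map_compose) auto
  then have "restrict (w \<circ> g) (topspace X) \<in> Cp X"
    by (rule restrict_in_Cp)
  then obtain h where h: "h \<in> Cp_star Y" "\<psi> h = restrict (w \<circ> g) (topspace X)"
    using surj by (metis imageE subsetD)
  obtain b where b: "\<And>y. y \<in> topspace Y \<Longrightarrow> \<bar>h y\<bar> \<le> b"
    using h(1) unfolding Cp_star_def bounded_iff by auto
  obtain n where n: "b \<le> real n" using real_arch_simple by blast
  have "\<psi> h (p n) \<le> B n"
    using B[OF h(1)] b n by (meson order_trans)
  moreover have "\<psi> h (p n) = B n + 1"
    using h(2) p[of n] w(2) by simp
  ultimately show False by simp
qed

text \<open>The set \<open>K\<close> varies with \<open>y\<close>, but closeness on the whole space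
  implies closeness on every \<open>K\<close>, while \<open>m\<close> is common to all
  \<open>y\<close>.\<close>

lemma bounded_Cp_map_uniform_bound:
  assumes "bounded_Cp_map X Y \<phi>"
  obtains m :: nat where "\<And>f g y. f \<in> Cp X \<Longrightarrow> g \<in> Cp X \<Longrightarrow> (\<And>x. x \<in> topspace X \<Longrightarrow> \<bar>f x - g x\<bar> < 1)
     \<Longrightarrow> y \<in> topspace Y \<Longrightarrow> \<bar>\<phi> f y - \<phi> g y\<bar> \<le> real m"
proof -
  obtain m :: nat where m: "\<And>y. y \<in> topspace Y \<Longrightarrow> \<exists>K. finite K \<and> K \<subseteq> topspace X \<and> a_phi X \<phi> y K \<le> of_nat m"
    using assms by (auto simp: bounded_Cp_map_def)
  have "\<bar>\<phi> f y - \<phi> g y\<bar> \<le> real m"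
    if "f \<in> Cp X" "g \<in> Cp X" "\<And>x. x \<in> topspace X \<Longrightarrow> \<bar>f x - g x\<bar> < 1" and y: "y \<in> topspace Y" for f g y
  proof -
    obtain K where K: "K \<subseteq> topspace X" "a_phi X \<phi> y K \<le> of_nat m" using m y by blast
    have "ennreal \<bar>\<phi> f y - \<phi> g y\<bar> \<le> a_phi X \<phi> y K"
      unfolding a_phi_def using that K(1) by (intro Sup_upper) blast
    also have "\<dots> \<le> ennreal (real m)" using K(2) by (simp add: ennreal_of_nat_eq_real_of_nat)
    finally show ?thesis by (simp add: ennreal_le_iff)
  qed
  then show thesis by (rule that)
qed

section \<open>Bumps along a discrete sequence\<close>

text \<open>
  The point \<open>-5\<close>, away from the nonnegative sequence \<open>r\<close>, keeps the set nonempty: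
  \<open>infdist t {} = 0\<close> would put the value 1 everywhere for \<open>a = {}\<close>.
\<close>
definition bumps :: "(nat \<Rightarrow> real) \<Rightarrow> nat set \<Rightarrow> real \<Rightarrow> real" where
  "bumps r a t = max 0 (1 - infdist t (insert (-5) (r ` a)))"

lemma bumps_bounds: "0 \<le> bumps r a t" "bumps r a t \<le> 1"
  by (simp_all add: bumps_def infdist_nonneg)

lemma continuous_on_bumps: "continuous_on UNIV (bumps r a)"
  unfolding bumps_def by (intro continuous_intros)

lemma le_infdistI:
  assumes "A \<noteq> {}" "\<And>a. a \<in> A \<Longrightarrow> c \<le> dist x a"
  shows "c \<le> infdist x A"
  unfolding infdist_notempty[OF assms(1)] using assms by (intro cINF_greatest)

lemma bumps_eq_1: "n \<in> a \<Longrightarrow> bumps r a (r n) = 1"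
  by (simp add: bumps_def)

lemma bumps_eq_0:
  assumes "\<And>i j. i < j \<Longrightarrow> r i + 2 < r j" "\<And>n. real n \<le> r n" "n \<notin> a"
  shows "bumps r a (r n) = 0"
proof -
  have "1 \<le> infdist (r n) (insert (-5) (r ` a))"
  proof (rule le_infdistI)
    fix s assume "s \<in> insert (-5) (r ` a)"
    then consider "s = -5" | i where "i \<in> a" "s = r i" by blast
    then show "1 \<le> dist (r n) s"
    proof cases
      case 1 then show ?thesis using assms(2)[of n] by (simp add: dist_real_def)
    next
      case 2
      then have "i \<noteq> n" using assms(3) by blast
      with 2 show ?thesis using assms(1)[of i n] assms(1)[of n i]
        by (cases i n rule: linorder_cases) (auto simp: dist_real_def)
    qed
  qed simp
  then show ?thesis by (simp add: bumps_def)
qed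

text \<open>A center \<open>r n\<close> with \<open>M \<le> n\<close> is at distance at least 1 from
  \<open>t\<close>, so its bump vanishes there.\<close>

lemma bumps_cong:
  assumes "\<And>n. M \<le> n \<Longrightarrow> t + 1 \<le> r n" "a \<inter> {..<M} = b \<inter> {..<M}"
  shows "bumps r a t = bumps r b t"
proof -
  \<comment> \<open>Truncation at 1 hides the centers on which \<open>a\<close> and \<open>b\<close>
    disagree; using this in both directions gives equal bumps.\<close>
  have *: "min 1 (infdist t (insert (-5) (r ` b))) \<le> infdist t (insert (-5) (r ` a))"
    if "a \<inter> {..<M} = b \<inter> {..<M}" for a b
  proof (rule le_infdistI)
    fix s assume s: "s \<in> insert (-5) (r ` a)"
    show "min 1 (infdist t (insert (-5) (r ` b))) \<le> dist t s"
    proof (cases "s \<in> insert (-5) (r ` b)")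
      case True
      then show ?thesis using infdist_le by (meson min.coboundedI2)
    next
      case False
      with s obtain n where n: "n \<in> a" "s = r n" "n \<notin> b" by blast
      then have "M \<le> n" using that by (metis IntE IntI lessThan_iff not_le)
      from assms(1)[OF this] n(2) show ?thesis by (simp add: dist_real_def)
    qed
  qed simp
  show ?thesis
    using *[OF assms(2)] *[OF assms(2)[symmetric]] unfolding bumps_def by linarith
qed

section \<open>Transfer of pseudocompactness\<close>

theorem bounded_inverse_imp_pseudocompact:
  assumes X: "pseudocompact_space X"
    and uc: "uniformly_continuous_wrt (Cp_star_uniformity Y) (Cp_uniformity X) \<psi>"
    and \<psi>: "\<psi> ` Cp_star Y \<subseteq> Cp X" "\<And>h. h \<in> Cp_star Y \<Longrightarrow> \<phi> (\<psi> h) = h"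
    and bdd: "bounded_Cp_map X Y \<phi>"
  shows "pseudocompact_space Y"
proof (rule ccontr)
  assume "\<not> pseudocompact_space Y"
  from not_pseudocompact_obtains_sequence[OF this] obtain g q
    where g: "continuous_map Y euclideanreal g" and q: "\<And>n. q n \<in> topspace Y"
      and gap: "\<And>i j. i < j \<Longrightarrow> g (q i) + 2 < g (q j)" and ge: "\<And>n. real n \<le> g (q n)"
    by blast
  obtain m :: nat where m: "\<And>f g y. f \<in> Cp X \<Longrightarrow> g \<in> Cp X
     \<Longrightarrow> (\<And>x. x \<in> topspace X \<Longrightarrow> \<bar>f x - g x\<bar> < 1) \<Longrightarrow> y \<in> topspace Y \<Longrightarrow> \<bar>\<phi> f y - \<phi> g y\<bar> \<le> real m"
    using bounded_Cp_map_uniform_bound[OF bdd] by metis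
  define r where "r n = g (q n)" for n
  \<comment> \<open>The height \<open>m + 1\<close> exceeds the bound \<open>m\<close> for
    \<open>\<phi>\<close>: distinct \<open>a\<close> and \<open>b\<close> differ at some
    \<open>n\<close>, where one of \<open>h a\<close> and \<open>h b\<close> is \<open>m + 1\<close>
    at \<open>q n\<close> and the other is 0.\<close>
  define h where "h a = restrict (\<lambda>y. real (Suc m) * bumps r a (g y)) (topspace Y)" for a
  have h: "h a \<in> Cp_star Y" for a
  proof -
    have "continuous_map Y euclideanreal (bumps r a \<circ> g)"
      using g continuous_on_bumps by (intro continuous_map_compose) auto
    then have "continuous_map Y euclideanreal (\<lambda>y. real (Suc m) * bumps r a (g y))"
      unfolding o_def by (rule continuous_map_real_mult_left)
    moreover have "bounded (h a ` topspace Y)"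
      unfolding bounded_iff
      by (rule exI[of _ "real (Suc m)"])
        (auto simp: h_def abs_mult bumps_bounds intro!: mult_left_le simp del: of_nat_Suc)
    ultimately show ?thesis
      unfolding Cp_star_def h_def using restrict_in_Cp by blast
  qed
  have far: "\<exists>y\<in>topspace Y. \<bar>h a y - h b y\<bar> > real m" if "a \<noteq> b" for a b
  proof -
    from that obtain n where n: "n \<in> a \<longleftrightarrow> n \<notin> b" by blast
    have "\<bar>bumps r a (r n) - bumps r b (r n)\<bar> = 1"
      using n bumps_eq_1[of n _ r] bumps_eq_0[of r n] gap ge unfolding r_def by auto
    then have "\<bar>h a (q n) - h b (q n)\<bar> = real (Suc m)"
      using q by (simp add: h_def r_def abs_mult flip: right_diff_distrib del: of_nat_Suc)
    then show ?thesis using q[of n] by (intro bexI[of _ "q n"]) simp_all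
  qed
  \<comment> \<open>This is continuity of \<open>a \<mapsto> \<psi> (h a) x\<close> on the Cantor
    set: \<open>g\<close> is bounded on the finite set \<open>K\<close>, while \<open>r n\<close>
    tends to infinity, so \<open>K\<close> meets only finitely many bumps.\<close>
  have tail: "\<exists>M. \<forall>a b. a \<inter> {..<M} = b \<inter> {..<M} \<longrightarrow> \<bar>\<psi> (h a) x - \<psi> (h b) x\<bar> < e"
    if x: "x \<in> topspace X" and e: "e > 0" for x e
  proof -
    obtain K d where K: "finite K" "d > 0"
      and *: "\<And>f g. f \<in> Cp_star Y \<Longrightarrow> g \<in> Cp_star Y \<Longrightarrow> (\<And>y. y \<in> K \<Longrightarrow> \<bar>f y - g y\<bar> < d)
         \<Longrightarrow> \<bar>\<psi> f x - \<psi> g x\<bar> < e"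
      using uniformly_continuous_pointwiseD[OF uc[unfolded Cp_star_uniformity_def Cp_uniformity_def] x e]
      by metis
    \<comment> \<open>The inserted 0 gives \<open>Max\<close> a meaning when \<open>K\<close> is
      empty; the added 1 is the radius of a bump.\<close>
    obtain M :: nat where M: "Max (insert 0 (g ` K)) + 1 \<le> real M" using real_arch_simple by blast
    have "g y + 1 \<le> r n" if "y \<in> K" "M \<le> n" for y n
    proof -
      have "g y \<le> Max (insert 0 (g ` K))" using that K(1) by (intro Max_ge) auto
      then show ?thesis using M ge[of n] that(2) unfolding r_def by linarith
    qed
    then have "h a y = h b y" if "y \<in> K" "a \<inter> {..<M} = b \<inter> {..<M}" for a b y
      using bumps_cong[of M "g y" r a b] that by (simp add: h_def restrict_def)
    then show ?thesis using *[OF h h] K(2) by (metis abs_zero diff_self)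
  qed
  let ?F = "range (\<lambda>a. \<psi> (h a))"
  have inj: "inj (\<lambda>a. \<psi> (h a))"
  proof (rule injI, rule ccontr)
    fix a b assume eq: "\<psi> (h a) = \<psi> (h b)" and "a \<noteq> b"
    from eq have "h a = h b" using \<psi>(2)[OF h] by metis
    with far[OF \<open>a \<noteq> b\<close>] show False by simp
  qed
  have "uncountable (UNIV :: nat set set)"
    using Cantors_theorem[of "UNIV :: nat set"] by (metis Pow_UNIV UNIV_not_empty uncountable_def)
  then have unc: "uncountable ?F"
    using countable_image_inj_eq[OF inj] by blast
  have cont: "\<psi> (h a) \<in> Cp X" for a using \<psi>(1) h by blast
  \<comment> \<open>Since \<open>set_decode\<close> enumerates the finite sets, the functions
    \<open>\<psi> (h (set_decode n))\<close> serve as the countable separating family.\<close>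
  have sep: "f x = f x'"
    if f: "f \<in> ?F" and x: "x \<in> topspace X" and x': "x' \<in> topspace X"
      and eq: "\<forall>n. \<psi> (h (set_decode n)) x = \<psi> (h (set_decode n)) x'" for f x x'
  proof -
    obtain a where a: "f = \<psi> (h a)" using f by blast
    have "\<bar>f x - f x'\<bar> \<le> e" if "e > 0" for e
    proof -
      obtain M where M: "\<And>a b. a \<inter> {..<M} = b \<inter> {..<M} \<Longrightarrow> \<bar>\<psi> (h a) x - \<psi> (h b) x\<bar> < e / 2"
        using tail[OF x, of "e / 2"] \<open>e > 0\<close> by auto
      obtain M' where M': "\<And>a b. a \<inter> {..<M'} = b \<inter> {..<M'} \<Longrightarrow> \<bar>\<psi> (h a) x' - \<psi> (h b) x'\<bar> < e / 2"
        using tail[OF x', of "e / 2"] \<open>e > 0\<close> by auto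
      \<comment> \<open>A finite truncation of \<open>a\<close> long enough for both points;
        replacing \<open>a\<close> by it costs less than \<open>e / 2\<close> at each.\<close>
      define b where "b = a \<inter> {..<max M M'}"
      have "\<psi> (h b) x = \<psi> (h b) x'"
        using eq set_encode_inverse[of b] by (metis b_def finite_Int finite_lessThan)
      moreover have "a \<inter> {..<M} = b \<inter> {..<M}" "a \<inter> {..<M'} = b \<inter> {..<M'}"
        by (auto simp: b_def)
      ultimately show ?thesis using M M' unfolding a by (smt (verit) field_sum_of_halves)
    qed
    then show ?thesis
      by (metis abs_ge_zero abs_le_zero_iff dense_ge eq_iff_diff_eq_0)
  qed
  have cont': "continuous_map X euclideanreal (\<psi> (h a))" for a
    using cont by (simp add: Cp_def)
  then have contF: "continuous_map X euclideanreal f" if "f \<in> ?F" for f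
    using that by auto
  obtain f f' where ff: "f \<in> ?F" "f' \<in> ?F" "f \<noteq> f'"
    and close: "\<And>x. x \<in> topspace X \<Longrightarrow> \<bar>f x - f' x\<bar> < 1"
    using pseudocompact_countably_separated_close[OF X cont' contF sep unc zero_less_one]
    by blast
  from ff obtain a b where ab: "f = \<psi> (h a)" "f' = \<psi> (h b)" "a \<noteq> b" by blast
  obtain y where y: "y \<in> topspace Y" "\<bar>h a y - h b y\<bar> > real m" using far[OF ab(3)] by blast
  \<comment> \<open>Applying \<open>\<phi>\<close> recovers \<open>h a\<close> and
    \<open>h b\<close>, which \<open>close\<close> now keeps within \<open>m\<close> of each other
    at \<open>y\<close>.\<close>
  have "\<bar>\<phi> f y - \<phi> f' y\<bar> \<le> real m"
    by (rule m[OF _ _ _ y(1)]) (use cont ab close in auto)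
  with y(2) show False using \<psi>(2)[OF h] ab by simp
qed

theorem mainTheorem3:
  fixes X :: "'a topology" and Y :: "'b topology"
    and \<phi> :: "('a \<Rightarrow> real) \<Rightarrow> ('b \<Rightarrow> real)"
  assumes "tychonoff_space X" and "tychonoff_space Y"
    and "uniform_homeomorphism (Cp X) (Cp_uniformity X) (Cp_star Y) (Cp_star_uniformity Y) \<phi>"
    and "bounded_Cp_map X Y \<phi>"
  shows "pseudocompact_space X \<longleftrightarrow> pseudocompact_space Y"
proof -
  define \<psi> where "\<psi> = inv_into (Cp X) \<phi>"
  have bij: "bij_betw \<phi> (Cp X) (Cp_star Y)"
    and uc: "uniformly_continuous_wrt (Cp_star_uniformity Y) (Cp_uniformity X) \<psi>"
    using assms(3) by (auto simp: uniform_homeomorphism_def \<psi>_def)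
  have im: "\<psi> ` Cp_star Y = Cp X"
    using bij_betw_inv_into[OF bij] by (simp add: \<psi>_def bij_betw_def)
  have inv: "\<phi> (\<psi> h) = h" if "h \<in> Cp_star Y" for h
    unfolding \<psi>_def using bij_betw_inv_into_right[OF bij that] .
  have "pseudocompact_space X"
    using uniformly_continuous_surj_imp_pseudocompact[OF uc] im by simp
  moreover from this have "pseudocompact_space Y"
    using bounded_inverse_imp_pseudocompact[OF _ uc _ inv assms(4)] im by simp
  ultimately show ?thesis by simp
qed

end
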